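(* The following seven identities form a basis of independent identities for the variety of nearlattices $(L,m)$: \begin{align*} \text{(P1)}\quad & m(x,y,x) = x, \\ \text{(P2)}\quad & m(x,x,y) = m(y,y,x), \\ \text{(P4)}\quad & m(x,y,z) = m(y,x,z), \\ \text{(P5)}\quad & m(m(x,y,z),w,z) = m(x,m(y,w,z),z), \\ \text{(P6)}\quad & m(x,m(y,y,x),z) = m(x,x,z), \\ \text{(P7)}\quad & m(x,x,m(x,y,z)) = m(x,x,z), \\ \text{(P8)}\quad & m(m(x,x,z),m(y,y,z),z) = m(x,y,z). \end{align*} That is, a ternary algebra $(L,m)$ is a nearlattice if and only if it satisfies these seven identities, and none of the seven identities is a consequence of the other six. In particular, the seven identities imply the identity $$\text{(P3)}\quad m(m(x,x,y),m(x,x,y),z) = m(x,x,m(y,y,z)).$$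
   Context: A (order-theoretic) nearlattice is a join semilattice $(L,\lor)$ such that for each $a\in L$ the principal filter $\{x\in L \mid a\le x\}$ is a lattice with respect to the induced order (where $x\le y$ iff $x\lor y=y$); the meet of $x,y$ in this principal filter is denoted $x\land_a y$. To such a structure one associates the ternary operation $$m(x,y,z)=(x\lor z)\land_z(y\lor z),\qquad x,y,z\in L.$$ A ternary algebra $(L,m)$ is called a nearlattice if $m$ arises in this way from some order-theoretic nearlattice on the set $L$ (in which case the join is recovered by $x\lor y=m(x,x,y)$, and $x\land_a y=m(x,y,a)$ for $x,y\ge a$). The class of such ternary algebras is a variety. A basis of identities for a variety is a set of identities whose class of models is exactly that variety. A set of identities is independent if for each identity in it there is an algebra satisfying all the others but not that one. All identities are universally quantified over the algebra. *)

theory Defs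
  imports "HOL-Algebra.Lattice"
begin

section \<open>Ternary algebras, terms and identities\<close>

text \<open>An algebra is given by an explicit carrier set, since independence of a set of identities
  asserts the existence of algebras. The empty carrier is not excluded; it makes no difference to
  independence, and it satisfies all identities as well as being an (empty) nearlattice.\<close>

type_synonym 'a ternary = "'a \<Rightarrow> 'a \<Rightarrow> 'a \<Rightarrow> 'a"

definition ternary_algebra :: "'a set \<Rightarrow> 'a ternary \<Rightarrow> bool" where
  "ternary_algebra L m \<longleftrightarrow> (\<forall>x\<in>L. \<forall>y\<in>L. \<forall>z\<in>L. m x y z \<in> L)"

datatype trm = Var nat | Op trm trm trm

datatype identity = Identity (lhs: trm) (rhs: trm)  (infix \<open>\<approx>\<close> 50)

primrec value_of :: "'a ternary \<Rightarrow> (nat \<Rightarrow> 'a) \<Rightarrow> trm \<Rightarrow> 'a" where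
  "value_of m v (Var i) = v i"
| "value_of m v (Op r s t) = m (value_of m v r) (value_of m v s) (value_of m v t)"

definition satisfies :: "'a set \<Rightarrow> 'a ternary \<Rightarrow> identity \<Rightarrow> bool" where
  "satisfies L m e \<longleftrightarrow> (\<forall>v. range v \<subseteq> L \<longrightarrow> value_of m v (lhs e) = value_of m v (rhs e))"

definition models :: "identity set \<Rightarrow> ('a set \<times> 'a ternary) set" where
  "models E = {(L, m). ternary_algebra L m \<and> (\<forall>e\<in>E. satisfies L m e)}"

definition is_basis :: "identity set \<Rightarrow> ('a set \<times> 'a ternary) set \<Rightarrow> bool" where
  "is_basis E K \<longleftrightarrow> models E = K"

text \<open>HOL cannot quantify existentially over types, so the separating algebras are required to have
  a carrier contained in \<^typ>\<open>nat\<close>. By the downward Loewenheim-Skolem theorem this is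
  equivalent to their existence over an arbitrary type.\<close>

definition independent_identities :: "identity set \<Rightarrow> bool" where
  "independent_identities E \<longleftrightarrow>
     (\<forall>e\<in>E. \<exists>(L :: nat set) m. (L, m) \<in> models (E - {e}) \<and> \<not> satisfies L m e)"

section \<open>Nearlattices\<close>

definition join_semilattice :: "'a set \<Rightarrow> ('a \<Rightarrow> 'a \<Rightarrow> 'a) \<Rightarrow> bool" where
  "join_semilattice L j \<longleftrightarrow>
     (\<forall>x\<in>L. \<forall>y\<in>L. j x y \<in> L) \<and>
     (\<forall>x\<in>L. \<forall>y\<in>L. \<forall>z\<in>L. j (j x y) z = j x (j y z)) \<and>
     (\<forall>x\<in>L. \<forall>y\<in>L. j x y = j y x) \<and>
     (\<forall>x\<in>L. j x x = x)"

definition join_le :: "('a \<Rightarrow> 'a \<Rightarrow> 'a) \<Rightarrow> 'a \<Rightarrow> 'a \<Rightarrow> bool" where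
  "join_le j x y \<longleftrightarrow> j x y = y"

definition principal_filter :: "'a set \<Rightarrow> ('a \<Rightarrow> 'a \<Rightarrow> 'a) \<Rightarrow> 'a \<Rightarrow> 'a gorder" where
  "principal_filter L j a = \<lparr>carrier = {x \<in> L. join_le j a x}, eq = (=), le = join_le j\<rparr>"

definition order_nearlattice :: "'a set \<Rightarrow> ('a \<Rightarrow> 'a \<Rightarrow> 'a) \<Rightarrow> bool" where
  "order_nearlattice L j \<longleftrightarrow>
     join_semilattice L j \<and> (\<forall>a\<in>L. lattice (principal_filter L j a))"

text \<open>The meet is formed in the principal filter of \<^term>\<open>z\<close>, which contains both joins.\<close>

definition nearlattice_op :: "'a set \<Rightarrow> ('a \<Rightarrow> 'a \<Rightarrow> 'a) \<Rightarrow> 'a ternary" where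
  "nearlattice_op L j x y z = j x z \<sqinter>\<^bsub>principal_filter L j z\<^esub> j y z"

definition nearlattices :: "('a set \<times> 'a ternary) set" where
  "nearlattices = {(L, m). ternary_algebra L m \<and>
     (\<exists>j. order_nearlattice L j \<and>
          (\<forall>x\<in>L. \<forall>y\<in>L. \<forall>z\<in>L. m x y z = nearlattice_op L j x y z))}"

section \<open>The identities\<close>

abbreviation (input) "x \<equiv> Var 0"
abbreviation (input) "y \<equiv> Var 1"
abbreviation (input) "z \<equiv> Var 2"
abbreviation (input) "w \<equiv> Var 3"

definition P1 :: identity where
  "P1 = (Op x y x \<approx> x)"

definition P2 :: identity where
  "P2 = (Op x x y \<approx> Op y y x)"

definition P3 :: identity where
  "P3 = (Op (Op x x y) (Op x x y) z \<approx> Op x x (Op y y z))"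

definition P4 :: identity where
  "P4 = (Op x y z \<approx> Op y x z)"

definition P5 :: identity where
  "P5 = (Op (Op x y z) w z \<approx> Op x (Op y w z) z)"

definition P6 :: identity where
  "P6 = (Op x (Op y y x) z \<approx> Op x x z)"

definition P7 :: identity where
  "P7 = (Op x x (Op x y z) \<approx> Op x x z)"

definition P8 :: identity where
  "P8 = (Op (Op x x z) (Op y y z) z \<approx> Op x y z)"

hide_const (open) x y z w

end

theory Submission
  imports Defs
begin

text \<open>
  Write \<open>x \<oplus> y\<close> for \<open>m x x y\<close> and, for fixed \<open>z\<close>, regard \<open>m x y z\<close> as a product of \<open>x\<close> and \<open>y\<close>.
  The identities P4 and P5 say that each such product is commutative and associative, P8 that it
  depends only on \<open>x \<oplus> z\<close> and \<open>y \<oplus> z\<close>, and P1 and P2 give that \<open>\<oplus>\<close> is idempotent and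
  commutative. Let \<open>x \<preceq> y\<close> mean \<open>x \<oplus> y = y\<close>.

  The missing associativity of \<open>\<oplus>\<close>, that is P3, comes from the interplay of P6 and P7: P6 makes
  \<open>m x y z = x \<oplus> z\<close> whenever \<open>x \<preceq> y\<close>, and P7, applied to \<open>y \<oplus> z\<close> and \<open>x \<oplus> z\<close>, then turns this
  into \<open>x \<oplus> z \<preceq> y \<oplus> z\<close> (lemma \<open>join_mono\<close>). A commutative idempotent operation that is monotone
  for its own \<open>\<preceq>\<close> and satisfies \<open>z \<preceq> x \<oplus> z\<close> is the supremum of a partial order, and suprema are
  associative. For \<open>x\<close> and \<open>y\<close> in the filter of \<open>z\<close>, P7 also makes \<open>m x y z\<close> a lower bound of \<open>x\<close>
  and \<open>y\<close>, and P5, P6 and P7 together make it the greatest one in that filter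
  (lemma \<open>prod_greatest\<close>).

  Conversely, in an order-theoretic nearlattice the elements of the filter of \<open>z\<close> below \<open>m x y z\<close>
  are those below both \<open>x \<oplus> z\<close> and \<open>y \<oplus> z\<close>; comparing such sets of lower bounds proves the
  identities.

  Independence is shown by seven algebras with at most five elements. Those for P5, P6, P7 and P8
  start from a genuine finite nearlattice and spoil the products \<open>m x y 0\<close> only, leaving the join
  as it is.
\<close>

section \<open>Identities as quantified equations\<close>

text \<open>All identities considered here have at most four variables, so an assignment only matters
  through its first four values.\<close>

lemma all_assignments_iff:
  "(\<forall>v :: nat \<Rightarrow> 'a. range v \<subseteq> L \<longrightarrow> Q (v 0) (v 1) (v 2) (v 3)) \<longleftrightarrow>
   (\<forall>x\<in>L. \<forall>y\<in>L. \<forall>z\<in>L. \<forall>w\<in>L. Q x y z w)"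
proof (intro iffI ballI)
  fix x y z w
  assume all: "\<forall>v :: nat \<Rightarrow> 'a. range v \<subseteq> L \<longrightarrow> Q (v 0) (v 1) (v 2) (v 3)"
    and "x \<in> L" "y \<in> L" "z \<in> L" "w \<in> L"
  define v :: "nat \<Rightarrow> 'a" where
    "v = (\<lambda>i. if i = 0 then x else if i = 1 then y else if i = 2 then z else w)"
  have "range v \<subseteq> L"
    using \<open>x \<in> L\<close> \<open>y \<in> L\<close> \<open>z \<in> L\<close> \<open>w \<in> L\<close> by (auto simp: v_def)
  with all have "Q (v 0) (v 1) (v 2) (v 3)" by blast
  then show "Q x y z w" by (simp add: v_def)
qed (auto simp: image_subset_iff)

lemma satisfies_P1: "satisfies L m P1 \<longleftrightarrow> (\<forall>x\<in>L. \<forall>y\<in>L. m x y x = x)"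
  using all_assignments_iff[of L "\<lambda>x y z w. m x y x = x"]
  unfolding satisfies_def P1_def by simp blast

lemma satisfies_P2: "satisfies L m P2 \<longleftrightarrow> (\<forall>x\<in>L. \<forall>y\<in>L. m x x y = m y y x)"
  using all_assignments_iff[of L "\<lambda>x y z w. m x x y = m y y x"]
  unfolding satisfies_def P2_def by simp blast

lemma satisfies_P3: "satisfies L m P3 \<longleftrightarrow>
    (\<forall>x\<in>L. \<forall>y\<in>L. \<forall>z\<in>L. m (m x x y) (m x x y) z = m x x (m y y z))"
  using all_assignments_iff[of L "\<lambda>x y z w. m (m x x y) (m x x y) z = m x x (m y y z)"]
  unfolding satisfies_def P3_def by simp blast

lemma satisfies_P4: "satisfies L m P4 \<longleftrightarrow> (\<forall>x\<in>L. \<forall>y\<in>L. \<forall>z\<in>L. m x y z = m y x z)"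
  using all_assignments_iff[of L "\<lambda>x y z w. m x y z = m y x z"]
  unfolding satisfies_def P4_def by simp blast

lemma satisfies_P5: "satisfies L m P5 \<longleftrightarrow>
    (\<forall>x\<in>L. \<forall>y\<in>L. \<forall>z\<in>L. \<forall>w\<in>L. m (m x y z) w z = m x (m y w z) z)"
  using all_assignments_iff[of L "\<lambda>x y z w. m (m x y z) w z = m x (m y w z) z"]
  unfolding satisfies_def P5_def by simp

lemma satisfies_P6: "satisfies L m P6 \<longleftrightarrow>
    (\<forall>x\<in>L. \<forall>y\<in>L. \<forall>z\<in>L. m x (m y y x) z = m x x z)"
  using all_assignments_iff[of L "\<lambda>x y z w. m x (m y y x) z = m x x z"]
  unfolding satisfies_def P6_def by simp blast

lemma satisfies_P7: "satisfies L m P7 \<longleftrightarrow>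
    (\<forall>x\<in>L. \<forall>y\<in>L. \<forall>z\<in>L. m x x (m x y z) = m x x z)"
  using all_assignments_iff[of L "\<lambda>x y z w. m x x (m x y z) = m x x z"]
  unfolding satisfies_def P7_def by simp blast

lemma satisfies_P8: "satisfies L m P8 \<longleftrightarrow>
    (\<forall>x\<in>L. \<forall>y\<in>L. \<forall>z\<in>L. m (m x x z) (m y y z) z = m x y z)"
  using all_assignments_iff[of L "\<lambda>x y z w. m (m x x z) (m y y z) z = m x y z"]
  unfolding satisfies_def P8_def by simp blast

lemmas satisfies_simps = satisfies_P1 satisfies_P2 satisfies_P4 satisfies_P5 satisfies_P6
  satisfies_P7 satisfies_P8

lemma mem_models_iff:
  "(L, m) \<in> models E \<longleftrightarrow> ternary_algebra L m \<and> (\<forall>e\<in>E. satisfies L m e)"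
  by (simp add: models_def)

section \<open>The order defined by the identities\<close>

locale nearlattice_identities =
  fixes L :: "'a set" and m :: "'a ternary"
  assumes closed: "\<lbrakk>x \<in> L; y \<in> L; z \<in> L\<rbrakk> \<Longrightarrow> m x y z \<in> L"
    and absorb: "\<lbrakk>x \<in> L; y \<in> L\<rbrakk> \<Longrightarrow> m x y x = x"
    and join_comm: "\<lbrakk>x \<in> L; y \<in> L\<rbrakk> \<Longrightarrow> m x x y = m y y x"
    and prod_comm: "\<lbrakk>x \<in> L; y \<in> L; z \<in> L\<rbrakk> \<Longrightarrow> m x y z = m y x z"
    and prod_assoc: "\<lbrakk>x \<in> L; y \<in> L; z \<in> L; w \<in> L\<rbrakk> \<Longrightarrow> m (m x y z) w z = m x (m y w z) z"
    and prod_join: "\<lbrakk>x \<in> L; y \<in> L; z \<in> L\<rbrakk> \<Longrightarrow> m x (m y y x) z = m x x z"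
    and join_prod: "\<lbrakk>x \<in> L; y \<in> L; z \<in> L\<rbrakk> \<Longrightarrow> m x x (m x y z) = m x x z"
    and prod_of_joins: "\<lbrakk>x \<in> L; y \<in> L; z \<in> L\<rbrakk> \<Longrightarrow> m (m x x z) (m y y z) z = m x y z"

lemma models_iff_nearlattice_identities:
  "(L, m) \<in> models {P1, P2, P4, P5, P6, P7, P8} \<longleftrightarrow> nearlattice_identities L m"
  unfolding mem_models_iff ternary_algebra_def nearlattice_identities_def
  by (simp add: satisfies_simps, simp add: Ball_def)

context nearlattice_identities
begin

abbreviation join :: "'a \<Rightarrow> 'a \<Rightarrow> 'a" (infixl "\<oplus>" 65) where "x \<oplus> y \<equiv> m x x y"

definition below :: "'a \<Rightarrow> 'a \<Rightarrow> bool" (infix "\<preceq>" 50) where "x \<preceq> y \<longleftrightarrow> x \<oplus> y = y"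

lemma join_le_join: "join_le join = below"
  by (simp add: fun_eq_iff join_le_def below_def)

lemma below_refl: "x \<in> L \<Longrightarrow> x \<preceq> x"
  by (simp add: below_def absorb)

lemma below_antisym: "\<lbrakk>x \<preceq> y; y \<preceq> x; x \<in> L; y \<in> L\<rbrakk> \<Longrightarrow> x = y"
  unfolding below_def using join_comm by metis

lemma prod_below: "\<lbrakk>x \<preceq> y; x \<in> L; y \<in> L; z \<in> L\<rbrakk> \<Longrightarrow> m x y z = x \<oplus> z"
  unfolding below_def using prod_join join_comm by metis

text \<open>Squaring \<open>m x y z\<close> in the product for \<open>z\<close> gives the product of the squares \<open>x \<oplus> z\<close> and
  \<open>y \<oplus> z\<close>, which is \<open>m x y z\<close> again by P8.\<close>

lemma third_below_prod:
  assumes "x \<in> L" "y \<in> L" "z \<in> L"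
  shows "z \<preceq> m x y z"
proof -
  let ?p = "m x y z"
  have "?p \<oplus> z = m x (m y (m x y z) z) z"
    using assms by (simp add: prod_assoc closed)
  also have "m y (m x y z) z = m (m y y z) x z"
    using assms by (metis prod_assoc prod_comm)
  also have "m x (m (m y y z) x z) z = m (m x x z) (m y y z) z"
    using assms by (metis prod_assoc prod_comm closed)
  also have "\<dots> = ?p"
    using assms by (simp add: prod_of_joins)
  finally show ?thesis
    unfolding below_def using assms join_comm closed by metis
qed

lemma right_below_join: "\<lbrakk>x \<in> L; z \<in> L\<rbrakk> \<Longrightarrow> z \<preceq> x \<oplus> z"
  by (rule third_below_prod)

lemma left_below_join: "\<lbrakk>x \<in> L; z \<in> L\<rbrakk> \<Longrightarrow> x \<preceq> x \<oplus> z"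
  by (metis right_below_join join_comm)

text \<open>The step that replaces the associative law: P7 sees the product of \<open>y \<oplus> z\<close> and \<open>x \<oplus> z\<close>,
  which P8 and P6 evaluate to \<open>x \<oplus> z\<close>.\<close>

lemma join_mono:
  assumes "x \<preceq> y" "x \<in> L" "y \<in> L" "z \<in> L"
  shows "x \<oplus> z \<preceq> y \<oplus> z"
proof -
  have "m (y \<oplus> z) (x \<oplus> z) z = x \<oplus> z"
    using assms by (metis prod_below prod_of_joins prod_comm)
  then have "(y \<oplus> z) \<oplus> (x \<oplus> z) = (y \<oplus> z) \<oplus> z"
    using assms by (metis join_prod closed)
  also have "\<dots> = y \<oplus> z"
    using assms right_below_join join_comm closed unfolding below_def by metis
  finally show ?thesis
    unfolding below_def using assms by (metis join_comm closed)
qed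

lemma below_trans:
  assumes "x \<preceq> y" "y \<preceq> z" "x \<in> L" "y \<in> L" "z \<in> L"
  shows "x \<preceq> z"
proof -
  have "x \<oplus> z \<preceq> z"
    using join_mono[OF assms(1,3,4,5)] assms(2) by (simp add: below_def)
  then have "x \<oplus> z = z"
    using assms by (metis below_antisym right_below_join closed)
  then show ?thesis by (simp add: below_def)
qed

lemma join_least:
  assumes "x \<preceq> u" "y \<preceq> u" "x \<in> L" "y \<in> L" "u \<in> L"
  shows "x \<oplus> y \<preceq> u"
proof -
  have "x \<oplus> y \<preceq> u \<oplus> y"
    using assms join_mono by blast
  also have "u \<oplus> y = u"
    using assms by (metis join_comm below_def)
  finally show ?thesis .
qed

lemma join_below_iff:
  "\<lbrakk>x \<in> L; y \<in> L; u \<in> L\<rbrakk> \<Longrightarrow> x \<oplus> y \<preceq> u \<longleftrightarrow> x \<preceq> u \<and> y \<preceq> u"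
  by (meson join_least below_trans left_below_join right_below_join closed)

lemma join_assoc:
  assumes "x \<in> L" "y \<in> L" "z \<in> L"
  shows "(x \<oplus> y) \<oplus> z = x \<oplus> (y \<oplus> z)"
proof (rule below_antisym)
  have "x \<oplus> (y \<oplus> z) \<preceq> x \<oplus> (y \<oplus> z)" "(x \<oplus> y) \<oplus> z \<preceq> (x \<oplus> y) \<oplus> z"
    using assms by (simp_all add: below_refl closed)
  then show "(x \<oplus> y) \<oplus> z \<preceq> x \<oplus> (y \<oplus> z)" "x \<oplus> (y \<oplus> z) \<preceq> (x \<oplus> y) \<oplus> z"
    using assms by (simp_all add: join_below_iff closed)
qed (use assms in \<open>simp_all add: closed\<close>)

lemma join_semilattice_join: "join_semilattice L join"
  unfolding join_semilattice_def
  using closed join_assoc join_comm absorb by blast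

section \<open>Meets in principal filters\<close>

text \<open>The two lemmas below rest on P7 with its conclusion read as \<open>x \<oplus> m x y z = x\<close>, which it
  becomes as soon as \<open>z \<preceq> x\<close>.\<close>

lemma prod_below_left:
  assumes "z \<preceq> x" "x \<in> L" "y \<in> L" "z \<in> L"
  shows "m x y z \<preceq> x"
proof -
  have "x \<oplus> m x y z = x"
    using assms join_prod join_comm unfolding below_def by metis
  then show ?thesis
    unfolding below_def using assms by (metis join_comm closed)
qed

text \<open>A lower bound \<open>u\<close> absorbs \<open>x\<close> and \<open>y\<close> in the product by P6, hence their product \<open>p\<close> by
  associativity; then P7, for \<open>p\<close> and \<open>u\<close>, says that \<open>u\<close> lies below \<open>p\<close>.\<close>

lemma prod_greatest:
  assumes "z \<preceq> u" "u \<preceq> x" "u \<preceq> y" "x \<in> L" "y \<in> L" "z \<in> L" "u \<in> L"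
  shows "u \<preceq> m x y z"
proof -
  let ?p = "m x y z"
  have "u \<oplus> z = u"
    using assms by (metis join_comm below_def)
  then have "m u x z = u" "m u y z = u"
    using assms by (simp_all add: prod_below)
  then have prod: "m ?p u z = u"
    using assms by (metis prod_assoc prod_comm closed)
  have "?p \<oplus> u = ?p \<oplus> m ?p u z"
    by (simp add: prod)
  also have "\<dots> = ?p \<oplus> z"
    using assms by (simp add: join_prod closed)
  also have "\<dots> = ?p"
    using assms third_below_prod join_comm closed unfolding below_def by metis
  finally show ?thesis
    unfolding below_def using assms by (metis join_comm closed)
qed

lemma partial_order_filter:
  assumes "a \<in> L"
  shows "partial_order (principal_filter L join a)"
  using below_refl below_antisym below_trans
  by unfold_locales (auto simp: principal_filter_def join_le_join)

lemma greatest_prod: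
  assumes "x \<in> L" "y \<in> L" "z \<in> L" "z \<preceq> x" "z \<preceq> y"
  shows "greatest (principal_filter L join z) (m x y z) (Lower (principal_filter L join z) {x, y})"
proof (rule greatest_LowerI)
  show "m x y z \<sqsubseteq>\<^bsub>principal_filter L join z\<^esub> u" if "u \<in> {x, y}" for u
    using that assms prod_below_left[of z x y] prod_below_left[of z y x] prod_comm[of x y z]
    by (auto simp: principal_filter_def join_le_join)
qed (use assms prod_greatest third_below_prod closed in
      \<open>auto simp: principal_filter_def join_le_join Lower_def\<close>)

lemma least_join:
  assumes "x \<in> L" "y \<in> L" "a \<in> L" "a \<preceq> x" "a \<preceq> y"
  shows "least (principal_filter L join a) (x \<oplus> y) (Upper (principal_filter L join a) {x, y})"
proof (rule least_UpperI)
  have "a \<preceq> x \<oplus> y"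
    using assms by (meson below_trans left_below_join closed)
  then show "x \<oplus> y \<in> carrier (principal_filter L join a)"
    using assms by (simp add: principal_filter_def join_le_join closed)
qed (use assms left_below_join right_below_join join_least in
      \<open>auto simp: principal_filter_def join_le_join Upper_def\<close>)

lemma lattice_filter:
  assumes "a \<in> L"
  shows "lattice (principal_filter L join a)"
proof -
  interpret partial_order "principal_filter L join a"
    using assms by (rule partial_order_filter)
  show ?thesis
  proof
    fix x y
    assume "x \<in> carrier (principal_filter L join a)" "y \<in> carrier (principal_filter L join a)"
    then have "x \<in> L" "a \<preceq> x" "y \<in> L" "a \<preceq> y"
      by (simp_all add: principal_filter_def join_le_join)
    then show "\<exists>s. least (principal_filter L join a) s (Upper (principal_filter L join a) {x, y})"
      and "\<exists>s. greatest (principal_filter L join a) s (Lower (principal_filter L join a) {x, y})"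
      using assms least_join greatest_prod by blast+
  qed
qed

lemma order_nearlattice_join: "order_nearlattice L join"
  using join_semilattice_join lattice_filter by (simp add: order_nearlattice_def)

lemma op_eq_nearlattice_op:
  assumes "x \<in> L" "y \<in> L" "z \<in> L"
  shows "m x y z = nearlattice_op L join x y z"
proof -
  interpret F: lattice "principal_filter L join z"
    using assms(3) by (rule lattice_filter)
  have filter: "x \<oplus> z \<in> L" "z \<preceq> x \<oplus> z" "y \<oplus> z \<in> L" "z \<preceq> y \<oplus> z"
    using assms by (simp_all add: closed right_below_join)
  then have "greatest (principal_filter L join z) (nearlattice_op L join x y z)
      (Lower (principal_filter L join z) {x \<oplus> z, y \<oplus> z})"
    unfolding nearlattice_op_def meet_def
    by (intro F.inf_of_two_greatest) (simp_all add: principal_filter_def join_le_join)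
  then have "m (x \<oplus> z) (y \<oplus> z) z = nearlattice_op L join x y z"
    using filter assms by (intro F.greatest_unique[OF greatest_prod])
  then show ?thesis
    using assms by (simp add: prod_of_joins)
qed

lemma mem_nearlattices: "(L, m) \<in> nearlattices"
  unfolding nearlattices_def ternary_algebra_def
  using closed order_nearlattice_join op_eq_nearlattice_op by blast

end

section \<open>Nearlattices satisfy the identities\<close>

locale order_theoretic_nearlattice =
  fixes L :: "'a set" and j :: "'a \<Rightarrow> 'a \<Rightarrow> 'a" (infixl "\<oplus>" 65) and m :: "'a ternary"
  assumes order_nearlattice: "order_nearlattice L (\<oplus>)"
    and op_eq: "\<lbrakk>x \<in> L; y \<in> L; z \<in> L\<rbrakk> \<Longrightarrow> m x y z = nearlattice_op L (\<oplus>) x y z"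
begin

abbreviation below :: "'a \<Rightarrow> 'a \<Rightarrow> bool" (infix "\<preceq>" 50) where "x \<preceq> y \<equiv> join_le (\<oplus>) x y"

lemma semilattice: "join_semilattice L (\<oplus>)"
  using order_nearlattice by (simp add: order_nearlattice_def)

lemma join_closed: "\<lbrakk>x \<in> L; y \<in> L\<rbrakk> \<Longrightarrow> x \<oplus> y \<in> L"
  and join_assoc: "\<lbrakk>x \<in> L; y \<in> L; z \<in> L\<rbrakk> \<Longrightarrow> (x \<oplus> y) \<oplus> z = x \<oplus> (y \<oplus> z)"
  and join_comm: "\<lbrakk>x \<in> L; y \<in> L\<rbrakk> \<Longrightarrow> x \<oplus> y = y \<oplus> x"
  and join_idem: "x \<in> L \<Longrightarrow> x \<oplus> x = x"
  using semilattice by (auto simp: join_semilattice_def)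

lemma below_refl: "x \<in> L \<Longrightarrow> x \<preceq> x"
  by (simp add: join_le_def join_idem)

lemma below_antisym: "\<lbrakk>x \<preceq> y; y \<preceq> x; x \<in> L; y \<in> L\<rbrakk> \<Longrightarrow> x = y"
  unfolding join_le_def using join_comm by metis

lemma below_trans: "\<lbrakk>x \<preceq> y; y \<preceq> z; x \<in> L; y \<in> L; z \<in> L\<rbrakk> \<Longrightarrow> x \<preceq> z"
  unfolding join_le_def using join_assoc by metis

lemma left_below_join: "\<lbrakk>x \<in> L; y \<in> L\<rbrakk> \<Longrightarrow> x \<preceq> x \<oplus> y"
  unfolding join_le_def using join_assoc join_idem by metis

lemma right_below_join: "\<lbrakk>x \<in> L; y \<in> L\<rbrakk> \<Longrightarrow> y \<preceq> x \<oplus> y"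
  using left_below_join join_comm by metis

lemma join_least: "\<lbrakk>x \<preceq> u; y \<preceq> u; x \<in> L; y \<in> L; u \<in> L\<rbrakk> \<Longrightarrow> x \<oplus> y \<preceq> u"
  unfolding join_le_def using join_assoc by metis

lemma join_mono:
  assumes "x \<preceq> y" "x \<in> L" "y \<in> L" "z \<in> L"
  shows "x \<oplus> z \<preceq> y \<oplus> z"
proof (rule join_least)
  show "x \<preceq> y \<oplus> z"
    using assms by (intro below_trans[OF assms(1)]) (simp_all add: left_below_join join_closed)
qed (use assms in \<open>simp_all add: right_below_join join_closed\<close>)

lemma greatest_prod:
  assumes "x \<in> L" "y \<in> L" "z \<in> L"
  shows "greatest (principal_filter L (\<oplus>) z) (m x y z)
    (Lower (principal_filter L (\<oplus>) z) {x \<oplus> z, y \<oplus> z})"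
proof -
  interpret F: lattice "principal_filter L (\<oplus>) z"
    using order_nearlattice assms(3) by (simp add: order_nearlattice_def)
  show ?thesis
    unfolding op_eq[OF assms] nearlattice_op_def meet_def
    by (rule F.inf_of_two_greatest)
      (simp_all add: principal_filter_def assms join_closed right_below_join)
qed

lemma prod_closed: "\<lbrakk>x \<in> L; y \<in> L; z \<in> L\<rbrakk> \<Longrightarrow> m x y z \<in> L"
  and third_below_prod: "\<lbrakk>x \<in> L; y \<in> L; z \<in> L\<rbrakk> \<Longrightarrow> z \<preceq> m x y z"
  using greatest_closed[OF greatest_prod] by (simp_all add: principal_filter_def)

lemma prod_below_left: "\<lbrakk>x \<in> L; y \<in> L; z \<in> L\<rbrakk> \<Longrightarrow> m x y z \<preceq> x \<oplus> z"
  and prod_below_right: "\<lbrakk>x \<in> L; y \<in> L; z \<in> L\<rbrakk> \<Longrightarrow> m x y z \<preceq> y \<oplus> z"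
  using greatest_mem[OF greatest_prod]
  by (auto simp: principal_filter_def Lower_def join_closed right_below_join)

lemma prod_greatest:
  "\<lbrakk>u \<preceq> x \<oplus> z; u \<preceq> y \<oplus> z; z \<preceq> u; x \<in> L; y \<in> L; z \<in> L; u \<in> L\<rbrakk> \<Longrightarrow> u \<preceq> m x y z"
  using greatest_le[OF greatest_prod, of x y z u]
  by (auto simp: principal_filter_def Lower_def)

lemma below_prod_iff:
  "\<lbrakk>z \<preceq> u; x \<in> L; y \<in> L; z \<in> L; u \<in> L\<rbrakk> \<Longrightarrow>
    u \<preceq> m x y z \<longleftrightarrow> u \<preceq> x \<oplus> z \<and> u \<preceq> y \<oplus> z"
  by (meson below_trans join_closed prod_below_left prod_below_right prod_closed prod_greatest)

lemma join_eq_of_below: "\<lbrakk>z \<preceq> x; x \<in> L; z \<in> L\<rbrakk> \<Longrightarrow> x \<oplus> z = x"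
  by (metis join_le_def join_comm)

text \<open>Elements of a filter are determined by the elements of the filter below them; with
  \<open>below_prod_iff\<close> this reduces equations between products to propositional logic.\<close>

lemma filter_eqI:
  assumes "z \<preceq> a" "z \<preceq> b" "a \<in> L" "b \<in> L"
    and "\<And>u. \<lbrakk>u \<in> L; z \<preceq> u\<rbrakk> \<Longrightarrow> u \<preceq> a \<longleftrightarrow> u \<preceq> b"
  shows "a = b"
  using assms by (meson below_antisym below_refl)

lemma prod_diagonal:
  assumes "x \<in> L" "z \<in> L"
  shows "m x x z = x \<oplus> z"
  by (rule filter_eqI[of z])
    (simp_all add: assms prod_closed join_closed third_below_prod right_below_join below_prod_iff)

lemma satisfies_identities: "nearlattice_identities L m"
proof
  fix x y z
  assume L: "x \<in> L" "y \<in> L" "z \<in> L"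
  show "m x y z \<in> L"
    using L by (rule prod_closed)
  show "m x y z = m y x z"
    by (rule filter_eqI[of z]) (use L in \<open>auto simp: prod_closed third_below_prod below_prod_iff\<close>)
  show "m (m x x z) (m y y z) z = m x y z"
    by (rule filter_eqI[of z])
      (use L in \<open>auto simp: prod_closed third_below_prod below_prod_iff prod_diagonal join_closed
        join_eq_of_below right_below_join\<close>)
  show "m x (m y y x) z = m x x z"
  proof -
    have "x \<oplus> z \<preceq> (y \<oplus> x) \<oplus> z"
      using L by (simp add: join_mono right_below_join join_closed)
    then have "u \<preceq> (y \<oplus> x) \<oplus> z" if "u \<preceq> x \<oplus> z" "u \<in> L" for u
      using that L by (meson below_trans join_closed)
    then show ?thesis
      by (intro filter_eqI[of z])
        (use L in \<open>auto simp: prod_closed third_below_prod below_prod_iff prod_diagonal join_closed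
          right_below_join\<close>)
  qed
  show "m x x (m x y z) = m x x z"
  proof -
    have "x \<oplus> m x y z = x \<oplus> z"
    proof (rule below_antisym)
      show "x \<oplus> m x y z \<preceq> x \<oplus> z"
        using L by (simp add: join_least join_closed prod_closed left_below_join prod_below_left)
      have "z \<oplus> x \<preceq> m x y z \<oplus> x"
        using L by (simp add: join_mono third_below_prod prod_closed)
      then show "x \<oplus> z \<preceq> x \<oplus> m x y z"
        using L by (simp add: join_comm prod_closed)
    qed (use L in \<open>simp_all add: join_closed prod_closed\<close>)
    then show ?thesis
      using L by (simp add: prod_diagonal prod_closed)
  qed
next
  fix x y
  assume L: "x \<in> L" "y \<in> L"
  show "m x y x = x"
    using L below_antisym prod_below_left[of x y x] third_below_prod[of x y x] prod_closed
    by (simp add: join_idem)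
  show "m x x y = m y y x"
    using L by (simp add: prod_diagonal join_comm)
next
  fix x y z w
  assume L: "x \<in> L" "y \<in> L" "z \<in> L" "w \<in> L"
  show "m (m x y z) w z = m x (m y w z) z"
    by (rule filter_eqI[of z])
      (use L in \<open>auto simp: prod_closed third_below_prod below_prod_iff join_eq_of_below\<close>)
qed

end

theorem nearlattices_eq_models: "models {P1, P2, P4, P5, P6, P7, P8} = nearlattices"
proof (intro Set.set_eqI iffI)
  fix A :: "'a set \<times> 'a ternary"
  obtain L m where A: "A = (L, m)" by (cases A)
  show "A \<in> nearlattices" if "A \<in> models {P1, P2, P4, P5, P6, P7, P8}"
    using that unfolding A models_iff_nearlattice_identities
    by (rule nearlattice_identities.mem_nearlattices)
  show "A \<in> models {P1, P2, P4, P5, P6, P7, P8}" if "A \<in> nearlattices"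
  proof -
    from that obtain j where "order_nearlattice L j"
      and "\<And>x y z. \<lbrakk>x \<in> L; y \<in> L; z \<in> L\<rbrakk> \<Longrightarrow> m x y z = nearlattice_op L j x y z"
      unfolding A nearlattices_def by auto
    then interpret order_theoretic_nearlattice L j m
      by unfold_locales
    show ?thesis
      unfolding A models_iff_nearlattice_identities by (rule satisfies_identities)
  qed
qed

section \<open>Independence\<close>

text \<open>Inequations in both directions, so that the simplifier can decide any equation between
  identities of the basis.\<close>

lemma identities_distinct:
  "distinct [P1, P2, P4, P5, P6, P7, P8]" "distinct [P8, P7, P6, P5, P4, P2, P1]"
  by (simp_all add: P1_def P2_def P4_def P5_def P6_def P7_def P8_def)

text \<open>Recording the truth value of every identity, instead of membership in a set of models, lets
  the seven verifications share one simplification, after which only quantifiers over explicit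
  finite sets remain.\<close>

definition separates :: "nat set \<Rightarrow> nat ternary \<Rightarrow> identity \<Rightarrow> bool" where
  "separates L m e \<longleftrightarrow> ternary_algebra L m \<and>
    (\<forall>e'\<in>{P1, P2, P4, P5, P6, P7, P8}. satisfies L m e' \<longleftrightarrow> e' \<noteq> e)"

lemma separates_iff:
  "separates L m e \<longleftrightarrow> ternary_algebra L m \<and>
    (satisfies L m P1 \<longleftrightarrow> P1 \<noteq> e) \<and> (satisfies L m P2 \<longleftrightarrow> P2 \<noteq> e) \<and>
    (satisfies L m P4 \<longleftrightarrow> P4 \<noteq> e) \<and> (satisfies L m P5 \<longleftrightarrow> P5 \<noteq> e) \<and>
    (satisfies L m P6 \<longleftrightarrow> P6 \<noteq> e) \<and> (satisfies L m P7 \<longleftrightarrow> P7 \<noteq> e) \<and>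
    (satisfies L m P8 \<longleftrightarrow> P8 \<noteq> e)"
  by (simp only: separates_def ball_simps simp_thms)

lemmas separates_simps = separates_iff ternary_algebra_def satisfies_simps
  identities_distinct[simplified] simp_thms

text \<open>The algebras for P1, P2 and P4 live on two elements. A constant operation violates only
  absorption. The third projection has \<open>x \<oplus> y = y\<close>, which is not commutative. In \<open>max x z\<close> the
  product is the first of its two factors joined to \<open>z\<close>, and so not commutative.\<close>

lemma separates_P1: "separates {0, 1} (\<lambda>x y z. 0) P1"
  by (simp only: separates_simps) code_simp

lemma separates_P2: "separates {0, 1} (\<lambda>x y z. z) P2"
  by (simp only: separates_simps) code_simp

lemma separates_P4: "separates {0, 1} (\<lambda>x y z. max x z) P4"
  by (simp only: separates_simps) code_simp

text \<open>The numbers \<open>0, 1, 3, 5, 7\<close>, read as sets of binary digits, form a lattice in which \<open>3\<close> and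
  \<open>5\<close> have meet \<open>1\<close>. Lowering this one product to \<open>0\<close> in the filter of \<open>0\<close> keeps it a common lower
  bound, but \<open>(3 \<cdot> 5) \<cdot> 1 = 0\<close> whereas \<open>3 \<cdot> (5 \<cdot> 1) = 1\<close>.\<close>

definition nonassociative_op :: "nat ternary" where
  "nonassociative_op x y z = (if z = 0 \<and> (x = 3 \<and> y = 5 \<or> x = 5 \<and> y = 3) then 0
                else and (or x z) (or y z))"

lemma separates_P5: "separates {0, 1, 3, 5, 7} nonassociative_op P5"
  by (simp only: separates_simps) code_simp

text \<open>A chain \<open>0 < 1 < 2\<close> in which the product of \<open>1\<close> and \<open>2\<close> in the filter of \<open>0\<close> is \<open>0\<close>
  instead of \<open>1\<close>: this semilattice product is no longer compatible with the order of the chain.\<close>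

lemma separates_P6: "separates {0, 1, 2} (\<lambda>x y z. if x = y then max x z else z) P6"
  by (simp only: separates_simps) code_simp

text \<open>On the four-element Boolean lattice of two-digit binary numbers, the product in the filter of
  \<open>0\<close> is taken from the chain \<open>0 < 1 < 2 < 3\<close>. This chain extends the Boolean order, which is all
  that P6 asks for, but \<open>1 \<cdot> 2 = 1\<close> is not below \<open>2\<close> in the Boolean order, as P7 demands.\<close>

definition linear_extension_op :: "nat ternary" where
  "linear_extension_op x y z = (if z = 0 then min x y else and (or x z) (or y z))"

lemma separates_P7: "separates {0, 1, 2, 3} linear_extension_op P7"
  by (simp only: separates_simps) code_simp

text \<open>Here \<open>0\<close> is the top element and \<open>1, 2, 3\<close> are pairwise incomparable below it. The filter of
  \<open>0\<close> has a single element, but the product for \<open>z = 0\<close> is defined on the whole carrier; the only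
  values other than \<open>0\<close> are \<open>1 \<cdot> 2 = 2 \<cdot> 1 = 3\<close>. It is associative because products of three
  factors vanish, and it does not factor through \<open>x \<mapsto> x \<oplus> 0\<close>, which is constant.\<close>

definition nilpotent_op :: "nat ternary" where
  "nilpotent_op x y z = (if z = 0 then if x = 1 \<and> y = 2 \<or> x = 2 \<and> y = 1 then 3 else 0
                else if x = z \<or> y = z then z else 0)"

lemma separates_P8: "separates {0, 1, 2, 3} nilpotent_op P8"
  by (simp only: separates_simps) code_simp

lemma separates_imp:
  assumes "separates L m e" "e \<in> {P1, P2, P4, P5, P6, P7, P8}"
  shows "(L, m) \<in> models ({P1, P2, P4, P5, P6, P7, P8} - {e}) \<and> \<not> satisfies L m e"
  using assms unfolding separates_def mem_models_iff by fast

theorem independent: "independent_identities {P1, P2, P4, P5, P6, P7, P8}"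
  unfolding independent_identities_def
proof
  fix e
  assume e: "e \<in> {P1, P2, P4, P5, P6, P7, P8}"
  then have "\<exists>L m. separates L m e"
    using separates_P1 separates_P2 separates_P4 separates_P5 separates_P6 separates_P7
      separates_P8 by blast
  with e show "\<exists>(L :: nat set) m.
      (L, m) \<in> models ({P1, P2, P4, P5, P6, P7, P8} - {e}) \<and> \<not> satisfies L m e"
    by (meson separates_imp)
qed

theorem theorem1p4:
  shows "is_basis {P1, P2, P4, P5, P6, P7, P8} (nearlattices :: ('a set \<times> 'a ternary) set)
    \<and> independent_identities {P1, P2, P4, P5, P6, P7, P8}
    \<and> (\<forall>(L :: 'a set) m. (L, m) \<in> models {P1, P2, P4, P5, P6, P7, P8} \<longrightarrow> satisfies L m P3)"
  using nearlattices_eq_models independent nearlattice_identities.join_assoc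
  by (auto simp: is_basis_def models_iff_nearlattice_identities satisfies_P3)

end
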